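(* Let the penalty function $F(\cdot,c_0)$ be bounded below on $Q$, let $\{(x_n,c_n)\}$ be a sequence generated by the primal-dual penalty method with tolerances $\{\varepsilon_n\}$, and put $\varepsilon_*=\limsup_{n\to\infty}\varepsilon_n$. Suppose also that there exists $s_*>0$ such that $s_n\ge s_*$ for all $n\in\mathbb{N}$. Then $\operatorname{dist}(0,\Phi(x_n))\to0$ as $n\to\infty$ and \[ \min\{f_*,\liminf_{y\to0}\beta(y)\}\le\liminf_{n\to\infty}f(x_n)\le\limsup_{n\to\infty}f(x_n)\le\min\{f_*,\liminf_{y\to0}\beta(y)\}+\varepsilon_* . \] In addition, if the optimal value function $\beta$ is lower semicontinuous at the origin, then \[ \limsup_{n\to\infty}c_n\,\omega\big(\operatorname{dist}(0,\Phi(x_n))\big)\le\varepsilon_* \] and the following statements hold: (1) if the functions $f$ and $\operatorname{dist}(0,\Phi(\cdot))$ are lower semicontinuous on $Q$ and $\Phi$ takes closed values on $Q$, then any limit point of $\{x_n\}$ (if such a point exists) is an $\varepsilon_*$-optimal solution of problem $(\mathcal{P})$; (2) if $\varepsilon_*=0$ and the sequence $\{c_n\}$ is bounded, then the penalty function $F$ is globally exact and $c_*:=\lim_{n\to\infty}c_n\ge c_*(F)$.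
   Context: Setting. $(X,d_X)$ is a metric space, $Y$ is a normed space, $Q\subset X$ is a nonempty closed set, $f\colon X\to\mathbb{R}\cup\{+\infty\}$, and $\Phi\colon X\rightrightarrows Y$ is a set-valued map. Problem $(\mathcal{P})$: minimize $f(x)$ subject to $0\in\Phi(x)$, $x\in Q$. Its feasible region is assumed nonempty and its optimal value $f_*$ is assumed finite. $\operatorname{dist}(0,\Phi(x))=\inf_{y\in\Phi(x)}\|y\|$ ($=+\infty$ if $\Phi(x)=\emptyset$). The optimal value function is $\beta(y)=\inf\{f(x)\mid x\in Q,\ 0\in\Phi(x)-y\}$, $y\in Y$ (with $\inf\emptyset=+\infty$), so $\beta(0)=f_*$; lower semicontinuity at the origin means $\beta(0)\le\liminf_{y\to0}\beta(y)$. Penalty function. Let $\mathbb{R}_+=[0,+\infty)$ and let $\omega\colon\mathbb{R}_+\to\mathbb{R}_+\cup\{+\infty\}$ be a nondecreasing function such that $\{t:\omega(t)<+\infty\}=[0,\tau)$ for some $\tau\in(0,+\infty]$, $\omega(0)=0$, $\omega$ is strictly increasing and continuous on $[0,\tau)$, and $\omega(t)\to+\infty$ as $t\to\tau$; put $\omega(+\infty)=+\infty$. Define $F(x,c)=f(x)+c\,\omega(\operatorname{dist}(0,\Phi(x)))$ for $x\in X$, $c\ge0$, with the convention $0\cdot(+\infty)=+\infty$. Primal-dual penalty method: choose $c_0\ge0$ and a bounded above sequence $\{\varepsilon_n\}\subset[0,+\infty)$. For each $n=0,1,2,\dots$: $x_n\in Q$ satisfies $F(x_n,c_n)\le F(x,c_n)+\varepsilon_n$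 for all $x\in Q$; then choose some $s_n>0$, $\delta_n\ge0$ and set $c_{n+1}=c_n+s_n[\omega(\operatorname{dist}(0,\Phi(x_n)))+\delta_n]$. The penalty function $F$ is called globally exact if there exists $c>0$ such that the problem of minimizing $F(x,c)$ over $x\in Q$ has the same globally optimal solutions as $(\mathcal{P})$; the infimum of all such $c$ is denoted $c_*(F)$ (the least exact penalty parameter). A limit point of a sequence is the limit of some convergent subsequence. For $\varepsilon\ge0$, an $\varepsilon$-optimal solution of $(\mathcal{P})$ is a feasible $x$ with $f(x)\le f_*+\varepsilon$.
   Formalization: Statement (2) is proved under the additional assumption, taken from (1), that Φ takes closed values on Q; without it (2) is false, e.g. Q={a,b}, f=0, Φ(a)={0}, Φ(b)=(0,1), c_0=0, x_n=a. *)

theory Defs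
  imports "HOL-Analysis.Analysis"
begin

(* Not infdist: infdist 0 {} = 0, whereas here the empty set is at distance \<infinity>. *)
definition dist0 :: "'b::real_normed_vector set \<Rightarrow> ereal" where
  "dist0 A = (INF y\<in>A. ereal (norm y))"

definition feasible :: "'a set \<Rightarrow> ('a \<Rightarrow> 'b::real_normed_vector set) \<Rightarrow> 'a set" where
  "feasible Q \<Phi> = {x \<in> Q. 0 \<in> \<Phi> x}"

definition opt_value :: "('a \<Rightarrow> ereal) \<Rightarrow> 'a set \<Rightarrow> ('a \<Rightarrow> 'b::real_normed_vector set) \<Rightarrow> ereal" where
  "opt_value f Q \<Phi> = (INF x\<in>feasible Q \<Phi>. f x)"

definition opt_value_fun ::
  "('a \<Rightarrow> ereal) \<Rightarrow> 'a set \<Rightarrow> ('a \<Rightarrow> 'b::real_normed_vector set) \<Rightarrow> 'b \<Rightarrow> ereal" where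
  "opt_value_fun f Q \<Phi> y = (INF x\<in>{x \<in> Q. 0 \<in> (\<lambda>z. z - y) ` \<Phi> x}. f x)"

definition eps_optimal ::
  "('a \<Rightarrow> ereal) \<Rightarrow> 'a set \<Rightarrow> ('a \<Rightarrow> 'b::real_normed_vector set) \<Rightarrow> ereal \<Rightarrow> 'a \<Rightarrow> bool" where
  "eps_optimal f Q \<Phi> \<epsilon> x \<longleftrightarrow> x \<in> feasible Q \<Phi> \<and> f x \<le> opt_value f Q \<Phi> + \<epsilon>"

(* Lower semicontinuity of the restriction of g to S; Liminf over the punctured
   relative neighbourhoods is enough, the value at x itself being harmless. *)
definition lsc_at_within :: "('a::topological_space \<Rightarrow> ereal) \<Rightarrow> 'a \<Rightarrow> 'a set \<Rightarrow> bool" where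
  "lsc_at_within g x S \<longleftrightarrow> g x \<le> Liminf (at x within S) g"

definition lsc_on :: "'a::topological_space set \<Rightarrow> ('a \<Rightarrow> ereal) \<Rightarrow> bool" where
  "lsc_on S g \<longleftrightarrow> (\<forall>x\<in>S. lsc_at_within g x S)"

(* The function \<omega> on [0,\<infinity>) together with its extension \<omega>(\<infinity>) = \<infinity> is a function on
   {0..} in ereal; its values at negative arguments are irrelevant. *)
definition penalty_weight :: "ereal \<Rightarrow> (ereal \<Rightarrow> ereal) \<Rightarrow> bool" where
  "penalty_weight \<tau> \<omega> \<longleftrightarrow>
     0 < \<tau> \<and> (\<forall>t\<ge>0. 0 \<le> \<omega> t) \<and> mono_on {0..} \<omega> \<and>
     {t. 0 \<le> t \<and> \<omega> t < \<infinity>} = {0..<\<tau>} \<and> \<omega> 0 = 0 \<and> \<omega> \<infinity> = \<infinity> \<and>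
     strict_mono_on {0..<\<tau>} \<omega> \<and> continuous_on {0..<\<tau>} \<omega> \<and>
     (\<omega> \<longlongrightarrow> \<infinity>) (at_left \<tau>)"

(* c * t with the convention 0 * \<infinity> = \<infinity>, whereas 0 * \<infinity> = 0 in ereal. *)
definition pen_mult :: "real \<Rightarrow> ereal \<Rightarrow> ereal" where
  "pen_mult c t = (if t = \<infinity> then \<infinity> else ereal c * t)"

definition penalty_function ::
  "('a \<Rightarrow> ereal) \<Rightarrow> ('a \<Rightarrow> 'b::real_normed_vector set) \<Rightarrow> (ereal \<Rightarrow> ereal) \<Rightarrow> 'a \<Rightarrow> real \<Rightarrow> ereal" where
  "penalty_function f \<Phi> \<omega> x c = f x + pen_mult c (\<omega> (dist0 (\<Phi> x)))"

definition global_minimizers :: "('a \<Rightarrow> ereal) \<Rightarrow> 'a set \<Rightarrow> 'a set" where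
  "global_minimizers g S = {x \<in> S. \<forall>z\<in>S. g x \<le> g z}"

definition exact_parameters ::
  "('a \<Rightarrow> ereal) \<Rightarrow> 'a set \<Rightarrow> ('a \<Rightarrow> 'b::real_normed_vector set) \<Rightarrow> (ereal \<Rightarrow> ereal) \<Rightarrow> real set" where
  "exact_parameters f Q \<Phi> \<omega> =
     {c. 0 < c \<and> global_minimizers (\<lambda>x. penalty_function f \<Phi> \<omega> x c) Q
                  = global_minimizers f (feasible Q \<Phi>)}"

definition globally_exact ::
  "('a \<Rightarrow> ereal) \<Rightarrow> 'a set \<Rightarrow> ('a \<Rightarrow> 'b::real_normed_vector set) \<Rightarrow> (ereal \<Rightarrow> ereal) \<Rightarrow> bool" where
  "globally_exact f Q \<Phi> \<omega> \<longleftrightarrow> (\<exists>c. c \<in> exact_parameters f Q \<Phi> \<omega>)"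

definition least_exact_parameter ::
  "('a \<Rightarrow> ereal) \<Rightarrow> 'a set \<Rightarrow> ('a \<Rightarrow> 'b::real_normed_vector set) \<Rightarrow> (ereal \<Rightarrow> ereal) \<Rightarrow> ereal" where
  "least_exact_parameter f Q \<Phi> \<omega> = (INF c\<in>exact_parameters f Q \<Phi> \<omega>. ereal c)"

(* The update is stated in ereal, so it includes that \<omega> (dist0 (\<Phi> (x n))) is finite;
   this is no restriction when the optimal value is finite, as the minimization
   step then forces a finite penalty term. *)
definition primal_dual_sequence ::
  "('a \<Rightarrow> ereal) \<Rightarrow> 'a set \<Rightarrow> ('a \<Rightarrow> 'b::real_normed_vector set) \<Rightarrow> (ereal \<Rightarrow> ereal) \<Rightarrow>
   (nat \<Rightarrow> real) \<Rightarrow> (nat \<Rightarrow> real) \<Rightarrow> (nat \<Rightarrow> real) \<Rightarrow> (nat \<Rightarrow> 'a) \<Rightarrow> (nat \<Rightarrow> real) \<Rightarrow> bool" where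
  "primal_dual_sequence f Q \<Phi> \<omega> \<epsilon> s \<delta> x c \<longleftrightarrow>
     0 \<le> c 0 \<and> (\<forall>n. 0 \<le> \<epsilon> n) \<and> bdd_above (range \<epsilon>) \<and>
     (\<forall>n. x n \<in> Q \<and>
       (\<forall>z\<in>Q. penalty_function f \<Phi> \<omega> (x n) (c n)
               \<le> penalty_function f \<Phi> \<omega> z (c n) + ereal (\<epsilon> n)) \<and>
       0 < s n \<and> 0 \<le> \<delta> n \<and>
       ereal (c (Suc n)) = ereal (c n) + ereal (s n) * (\<omega> (dist0 (\<Phi> (x n))) + ereal (\<delta> n)))"

end

theory Submission
  imports Defs
begin

text \<open>
  The theorem compares the method with one number, \<open>L = min f\<^sub>* (lim inf \<beta>)\<close>, which is best read as a
  relaxed optimal value: it is the limit, as \<open>r\<close> decreases to 0, of the infimum of \<open>f\<close> over the points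
  of \<open>Q\<close> with \<open>dist(0, \<Phi>(x)) < r\<close> (lemmas \<open>near_feasible_value_le\<close> and \<open>near_feasible_value_above\<close>).

  The upper estimate holds for every single iterate. Points that violate the constraint by an arbitrarily
  small amount have an arbitrarily small penalty, whatever the fixed penalty parameter is, so the
  infimum of \<open>F(\<sqdot>, c)\<close> over \<open>Q\<close> never exceeds \<open>L\<close> (lemma \<open>penalty_infimum_le\<close>). An approximate
  minimizer therefore satisfies \<open>f(x\<^sub>n) + c\<^sub>n \<omega>\<^sub>n \<le> L + \<epsilon>\<^sub>n\<close>, where \<open>\<omega>\<^sub>n\<close> is the penalty term at
  \<open>x\<^sub>n\<close>.

  Asymptotic feasibility has two causes, depending on the penalty parameters. If they are unbounded,
  this estimate and the lower bound on \<open>F(\<sqdot>, c\<^sub>0)\<close> bound \<open>(c\<^sub>n - c\<^sub>0) \<omega>\<^sub>n\<close>; if they are bounded, they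
  converge, and \<open>\<omega>\<^sub>n\<close> is at most a constant times the increment \<open>c\<^sub>n\<^sub>+\<^sub>1 - c\<^sub>n\<close>. In both cases
  \<open>\<omega>\<^sub>n\<close> tends to 0 (lemma \<open>penalty_terms_tendsto_0\<close>), hence so do the distances, and then the
  description of \<open>L\<close> as a limit gives the lower estimate for \<open>f(x\<^sub>n)\<close>.

  Lower semicontinuity of \<open>\<beta>\<close> at 0 says that \<open>L = f\<^sub>*\<close>. The estimate of \<open>c\<^sub>n \<omega>\<^sub>n\<close> is then what is left
  when the lower estimate for \<open>f(x\<^sub>n)\<close> is subtracted from the upper one, and limit points are handled
  by lower semicontinuity. If moreover \<open>\<epsilon>\<^sub>* = 0\<close> and \<open>c\<^sub>n\<close> increases to \<open>c\<^sub>*\<close>, then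
  \<open>f(x\<^sub>n) \<le> F(z, c\<^sub>*) + \<epsilon>\<^sub>n\<close> for all \<open>z\<close> in \<open>Q\<close>, so that \<open>f\<^sub>* \<le> F(z, c\<^sub>*)\<close>; any larger parameter
  makes this inequality strict at infeasible points, whose distance to the constraint is positive when
  \<open>\<Phi>\<close> has closed values, and is therefore exact (lemma \<open>exact_above_valid_parameter\<close>).
\<close>

section \<open>The distance to the constraint and the penalty term\<close>

lemma dist0_nonneg: "0 \<le> dist0 A"
  unfolding dist0_def by (auto intro!: INF_greatest)

lemma dist0_less_iff: "dist0 A < r \<longleftrightarrow> (\<exists>y\<in>A. ereal (norm y) < r)"
  unfolding dist0_def by (simp add: INF_less_iff)

lemma dist0_eq_0I:
  assumes "0 \<in> A"
  shows "dist0 A = 0"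
proof -
  have "dist0 A \<le> ereal (norm (0::'a))"
    unfolding dist0_def using assms by (intro INF_lower)
  then show ?thesis
    using dist0_nonneg[of A] by (simp add: zero_ereal_def)
qed

lemma zero_in_closed_if_dist0_eq_0:
  assumes "closed A" "dist0 A = 0"
  shows "0 \<in> A"
proof -
  have "\<exists>y\<in>A. dist y 0 < e" if "e > 0" for e
    using that assms(2) dist0_less_iff[of A "ereal e"] by auto
  then show ?thesis
    using closed_approachable[OF assms(1)] by blast
qed

lemma penalty_weight_nonneg: "penalty_weight \<tau> \<omega> \<Longrightarrow> 0 \<le> t \<Longrightarrow> 0 \<le> \<omega> t"
  by (simp add: penalty_weight_def)

lemma penalty_weight_mono: "penalty_weight \<tau> \<omega> \<Longrightarrow> 0 \<le> t \<Longrightarrow> t \<le> u \<Longrightarrow> \<omega> t \<le> \<omega> u"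
  by (simp add: penalty_weight_def mono_on_def)

lemma penalty_weight_pos:
  assumes "penalty_weight \<tau> \<omega>" "0 < t"
  shows "0 < \<omega> t"
proof (cases "t < \<tau>")
  case True
  then have "\<omega> 0 < \<omega> t"
    using assms by (intro strict_mono_onD[of "{0..<\<tau>}" \<omega>]) (auto simp: penalty_weight_def)
  then show ?thesis
    using assms by (simp add: penalty_weight_def)
next
  case False
  then have "t \<notin> {t. 0 \<le> t \<and> \<omega> t < \<infinity>}"
    using assms(1) by (simp add: penalty_weight_def)
  then have "\<omega> t = \<infinity>"
    using assms(2) by auto
  then show ?thesis by simp
qed

lemma penalty_weight_small:
  assumes "penalty_weight \<tau> \<omega>" "0 < e"
  obtains r :: real where "0 < r" "\<And>t. 0 \<le> t \<Longrightarrow> t < ereal r \<Longrightarrow> \<omega> t < e"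
proof -
  have "0 < \<tau>" "\<omega> 0 = 0" and cont: "continuous_on {0..<\<tau>} \<omega>"
    using assms(1) by (auto simp: penalty_weight_def)
  have "(\<omega> \<longlongrightarrow> \<omega> 0) (at 0 within {0..<\<tau>})"
    using cont \<open>0 < \<tau>\<close> by (auto simp: continuous_on_def)
  then have "eventually (\<lambda>t. \<omega> t < e) (at 0 within {0..<\<tau>})"
    using assms(2) \<open>\<omega> 0 = 0\<close> by (auto dest: order_tendstoD(2))
  then have "eventually (\<lambda>t. t \<noteq> 0 \<longrightarrow> t \<in> {0..<\<tau>} \<longrightarrow> \<omega> t < e) (nhds 0)"
    by (simp add: eventually_at_filter)
  then obtain U where U: "open U" "0 \<in> U" "\<And>t. t \<in> U \<Longrightarrow> t \<noteq> 0 \<Longrightarrow> t \<in> {0..<\<tau>} \<Longrightarrow> \<omega> t < e"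
    unfolding eventually_nhds by blast
  have "open (U \<inter> {..<\<tau>})" "0 \<in> U \<inter> {..<\<tau>}"
    using U \<open>0 < \<tau>\<close> by auto
  then obtain b where b: "0 < b" "{0..<b} \<subseteq> U \<inter> {..<\<tau>}"
    using open_right[of "U \<inter> {..<\<tau>}" 0 \<tau>] \<open>0 < \<tau>\<close> by auto
  obtain r where r: "0 < ereal r" "ereal r < b"
    using ereal_dense2[OF b(1)] by blast
  have small: "\<omega> t < e" if t: "0 \<le> t" "t < ereal r" for t
  proof (cases "t = 0")
    case False
    have "t \<in> {0..<b}" using t r(2) by auto
    then have "t \<in> U" "t < \<tau>" using b(2) by auto
    then show ?thesis using U(3) False t(1) by auto
  qed (use \<open>\<omega> 0 = 0\<close> assms(2) in simp)
  have "0 < r" using r(1) by simp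
  then show ?thesis using small by (rule that)
qed

text \<open>Since the weight is strictly positive away from 0 and monotone, small penalty terms force small
  distances.\<close>

lemma tendsto_0_if_penalty_weight_tendsto_0:
  assumes \<omega>: "penalty_weight \<tau> \<omega>" and nonneg: "\<And>n. 0 \<le> d n" and lim: "(\<lambda>n. \<omega> (d n)) \<longlonglongrightarrow> 0"
  shows "d \<longlonglongrightarrow> 0"
proof (rule order_tendstoI)
  fix a :: ereal assume "a < 0"
  then show "eventually (\<lambda>n. a < d n) sequentially"
    using nonneg less_le_trans by (intro always_eventually) blast
next
  fix a :: ereal assume a: "0 < a"
  have "eventually (\<lambda>n. \<omega> (d n) < \<omega> a) sequentially"
    using lim penalty_weight_pos[OF \<omega> a] by (rule order_tendstoD(2))
  then show "eventually (\<lambda>n. d n < a) sequentially"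
    by eventually_elim (use penalty_weight_mono[OF \<omega>] a in \<open>meson less_imp_le not_le\<close>)
qed

lemma pen_mult_nonneg: "0 \<le> c \<Longrightarrow> 0 \<le> t \<Longrightarrow> 0 \<le> pen_mult c t"
  by (simp add: pen_mult_def)

lemma pen_mult_ereal [simp]: "pen_mult c (ereal t) = ereal (c * t)"
  by (simp add: pen_mult_def)

lemma pen_mult_mono: "c \<le> c' \<Longrightarrow> 0 \<le> t \<Longrightarrow> pen_mult c t \<le> pen_mult c' t"
  by (auto simp: pen_mult_def intro: ereal_mult_right_mono)

lemma penalty_function_mono:
  assumes "penalty_weight \<tau> \<omega>" "c \<le> c'"
  shows "penalty_function f \<Phi> \<omega> z c \<le> penalty_function f \<Phi> \<omega> z c'"
  unfolding penalty_function_def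
  by (intro add_left_mono pen_mult_mono assms(2) penalty_weight_nonneg[OF assms(1)] dist0_nonneg)

lemma le_penalty_function:
  assumes "penalty_weight \<tau> \<omega>" "0 \<le> c"
  shows "f z \<le> penalty_function f \<Phi> \<omega> z c"
  unfolding penalty_function_def
  by (intro add_increasing2 pen_mult_nonneg assms(2) penalty_weight_nonneg[OF assms(1)]
      dist0_nonneg order_refl)

lemma penalty_function_feasible:
  assumes "penalty_weight \<tau> \<omega>" "z \<in> feasible Q \<Phi>"
  shows "penalty_function f \<Phi> \<omega> z c = f z"
  using assms by (simp add: penalty_function_def feasible_def dist0_eq_0I penalty_weight_def pen_mult_def)

section \<open>The relaxed optimal value\<close>

lemma opt_value_fun_eq: "opt_value_fun f Q \<Phi> y = (INF x\<in>{x \<in> Q. y \<in> \<Phi> x}. f x)"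
proof -
  have "{x \<in> Q. 0 \<in> (\<lambda>z. z - y) ` \<Phi> x} = {x \<in> Q. y \<in> \<Phi> x}" by force
  then show ?thesis by (simp add: opt_value_fun_def)
qed

lemma opt_value_fun_0: "opt_value_fun f Q \<Phi> 0 = opt_value f Q \<Phi>"
  by (simp add: opt_value_fun_eq opt_value_def feasible_def)

definition near_feasible_value ::
  "('a \<Rightarrow> ereal) \<Rightarrow> 'a set \<Rightarrow> ('a \<Rightarrow> 'b::real_normed_vector set) \<Rightarrow> real \<Rightarrow> ereal" where
  "near_feasible_value f Q \<Phi> r = (INF x\<in>{x \<in> Q. dist0 (\<Phi> x) < ereal r}. f x)"

text \<open>A point \<open>x\<close> has \<open>dist(0, \<Phi>(x)) < r\<close> exactly if it is feasible for the problem perturbed by some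
  \<open>y\<close> with \<open>\<parallel>y\<parallel> < r\<close>; so the near-feasible value at \<open>r\<close> is the infimum of \<open>\<beta>\<close> over the open ball of
  radius \<open>r\<close>. The centre of the ball contributes \<open>f\<^sub>*\<close>, the remaining points are those seen by the
  limes inferior.\<close>

lemma near_feasible_value_le:
  assumes "0 < r"
  shows "near_feasible_value f Q \<Phi> r \<le> min (opt_value f Q \<Phi>) (Liminf (at 0) (opt_value_fun f Q \<Phi>))"
proof -
  have le: "near_feasible_value f Q \<Phi> r \<le> opt_value_fun f Q \<Phi> y" if "norm y < r" for y
    unfolding near_feasible_value_def opt_value_fun_eq
    by (rule INF_superset_mono) (use that in \<open>auto simp: dist0_less_iff\<close>)
  have "eventually (\<lambda>y. near_feasible_value f Q \<Phi> r \<le> opt_value_fun f Q \<Phi> y) (at 0)"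
    unfolding eventually_at using assms le by (auto intro!: exI[of _ r])
  then show ?thesis
    using le[of 0] assms by (auto simp: opt_value_fun_0 intro: Liminf_bounded)
qed

lemma near_feasible_value_above:
  assumes "l < min (opt_value f Q \<Phi>) (Liminf (at 0) (opt_value_fun f Q \<Phi>))"
  obtains r where "0 < r" "\<And>z. z \<in> Q \<Longrightarrow> dist0 (\<Phi> z) < ereal r \<Longrightarrow> l < f z"
proof -
  have at0: "l < opt_value_fun f Q \<Phi> 0"
    using assms by (simp add: opt_value_fun_0)
  have "eventually (\<lambda>y. l < opt_value_fun f Q \<Phi> y) (at 0)"
    using assms by (auto intro: less_LiminfD)
  then obtain r where r: "0 < r" "\<And>y. y \<noteq> 0 \<Longrightarrow> norm y < r \<Longrightarrow> l < opt_value_fun f Q \<Phi> y"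
    unfolding eventually_at by auto
  have "l < f z" if z: "z \<in> Q" "dist0 (\<Phi> z) < ereal r" for z
  proof -
    obtain y where y: "y \<in> \<Phi> z" "norm y < r"
      using z(2) by (auto simp: dist0_less_iff)
    have "l < opt_value_fun f Q \<Phi> y"
      using at0 r(2) y(2) by (cases "y = 0") auto
    also have "\<dots> \<le> f z"
      unfolding opt_value_fun_eq using z(1) y(1) by (intro INF_lower) auto
    finally show ?thesis .
  qed
  with r(1) show ?thesis by (rule that)
qed

text \<open>However large the fixed parameter \<open>c\<close> is, the penalty of a point can be made negligible by choosing
  the point close enough to feasibility, and near-feasible points suffice to approach the relaxed
  value.\<close>

lemma penalty_infimum_le:
  assumes \<omega>: "penalty_weight \<tau> \<omega>" and c: "0 \<le> c"
  shows "(INF z\<in>Q. penalty_function f \<Phi> \<omega> z c)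
    \<le> min (opt_value f Q \<Phi>) (Liminf (at 0) (opt_value_fun f Q \<Phi>))" (is "_ \<le> ?L")
proof (rule dense_ge)
  fix u assume "?L < u"
  then obtain b where b: "?L < ereal b" "ereal b < u"
    using ereal_dense2 by blast
  obtain a where a: "?L < ereal a" "ereal a < ereal b"
    using ereal_dense2[OF b(1)] by blast
  \<comment> \<open>The summand 1 keeps the denominator positive when \<open>c = 0\<close>.\<close>
  define e where "e = (b - a) / (c + 1)"
  have e: "0 < e" and ce: "c * e \<le> b - a"
  proof -
    have "a < b" using a(2) by simp
    then show "0 < e" using c by (simp add: e_def)
    have "c * (b - a) \<le> (c + 1) * (b - a)"
      using c \<open>a < b\<close> by (intro mult_right_mono) auto
    then show "c * e \<le> b - a"
      using c by (simp add: e_def field_simps)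
  qed
  obtain r :: real where r: "0 < r" "\<And>t. 0 \<le> t \<Longrightarrow> t < ereal r \<Longrightarrow> \<omega> t < ereal e"
    using penalty_weight_small[OF \<omega>, of "ereal e"] e by auto
  have "near_feasible_value f Q \<Phi> r < ereal a"
    using near_feasible_value_le[OF r(1)] a(1) by (rule le_less_trans)
  then obtain z where z: "z \<in> Q" "dist0 (\<Phi> z) < ereal r" "f z < ereal a"
    by (auto simp: near_feasible_value_def INF_less_iff)
  have "0 \<le> \<omega> (dist0 (\<Phi> z))" "\<omega> (dist0 (\<Phi> z)) < ereal e"
    using penalty_weight_nonneg[OF \<omega>] r(2) z(2) dist0_nonneg by auto
  then obtain t where t: "\<omega> (dist0 (\<Phi> z)) = ereal t" "t < e"
    by (cases "\<omega> (dist0 (\<Phi> z))") auto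
  have "c * t \<le> b - a"
    using ce mult_left_mono[OF less_imp_le[OF t(2)] c] by linarith
  then have "penalty_function f \<Phi> \<omega> z c \<le> ereal a + ereal (b - a)"
    unfolding penalty_function_def t(1) using z(3) by (intro add_mono) auto
  then have "penalty_function f \<Phi> \<omega> z c \<le> u"
    using b(2) by simp
  then show "(INF z\<in>Q. penalty_function f \<Phi> \<omega> z c) \<le> u"
    by (rule INF_lower2[OF z(1)])
qed

section \<open>Vanishing of the penalty terms\<close>

text \<open>If the parameters \<open>c\<close> are bounded they converge, and their increments dominate the penalty terms
  \<open>w\<close>; if they are unbounded, the third assumption makes \<open>w\<close> decay like \<open>1 / c\<close>.\<close>

lemma penalty_terms_tendsto_0:
  fixes c w :: "nat \<Rightarrow> real"
  assumes w: "\<And>n. 0 \<le> w n" and \<sigma>: "0 < \<sigma>" and step: "\<And>n. c n + \<sigma> * w n \<le> c (Suc n)"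
    and bound: "\<And>n. (c n - c 0) * w n \<le> K"
  shows "w \<longlonglongrightarrow> 0"
proof -
  have "c n \<le> c (Suc n)" for n
    using step[of n] w[of n] \<sigma> by (meson add_increasing2 order_refl order_trans less_imp_le mult_nonneg_nonneg)
  then have inc: "incseq c"
    by (rule incseq_SucI)
  show ?thesis
  proof (cases "\<exists>B. \<forall>n. c n \<le> B")
    case True
    then obtain B where "\<And>n. c n \<le> B" by blast
    then obtain l where l: "c \<longlonglongrightarrow> l"
      using incseq_convergent[OF inc] by blast
    have "(\<lambda>n. (c (Suc n) - c n) / \<sigma>) \<longlonglongrightarrow> (l - l) / \<sigma>"
      by (intro tendsto_intros l LIMSEQ_Suc) (use \<sigma> in auto)
    then have lim: "(\<lambda>n. (c (Suc n) - c n) / \<sigma>) \<longlonglongrightarrow> 0" by simp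
    have "w n \<le> (c (Suc n) - c n) / \<sigma>" for n
      using step[of n] \<sigma> by (simp add: field_simps)
    then show ?thesis
      using w by (intro tendsto_sandwich[OF _ _ tendsto_const lim]) auto
  next
    case False
    have "filterlim c at_top sequentially"
      unfolding filterlim_at_top
    proof
      fix B
      obtain N where "B \<le> c N" using False by (meson le_cases)
      then show "eventually (\<lambda>n. B \<le> c n) sequentially"
        using inc by (auto simp: eventually_sequentially incseq_def intro!: exI[of _ N] intro: order_trans)
    qed
    then have top: "filterlim (\<lambda>n. - c 0 + c n) at_top sequentially"
      by (rule filterlim_tendsto_add_at_top[OF tendsto_const])
    then have lim: "(\<lambda>n. K / (- c 0 + c n)) \<longlonglongrightarrow> 0"
      by (intro tendsto_divide_0[OF tendsto_const] filterlim_at_top_imp_at_infinity)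
    have "eventually (\<lambda>n. 0 < - c 0 + c n) sequentially"
      using top unfolding filterlim_at_top_dense by blast
    then have "eventually (\<lambda>n. w n \<le> K / (- c 0 + c n)) sequentially"
      by eventually_elim (use bound in \<open>simp add: field_simps\<close>)
    then show ?thesis
      using w by (intro tendsto_sandwich[OF _ _ tendsto_const lim]) auto
  qed
qed

text \<open>The extended-real update forces the penalty terms of the iterates to be finite, so that the whole
  recursion can be read in the reals.\<close>

lemma primal_dual_sequence_realE:
  assumes "primal_dual_sequence f Q \<Phi> \<omega> \<epsilon> s \<delta> x c" "penalty_weight \<tau> \<omega>"
  obtains w where "\<And>n. \<omega> (dist0 (\<Phi> (x n))) = ereal (w n)" "\<And>n. 0 \<le> w n"
    "\<And>n. c n + s n * w n \<le> c (Suc n)" "\<And>n. 0 \<le> c n"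
proof -
  define w where "w n = real_of_ereal (\<omega> (dist0 (\<Phi> (x n))))" for n
  have \<omega>0: "0 \<le> \<omega> (dist0 (\<Phi> (x n)))" for n
    by (rule penalty_weight_nonneg[OF assms(2) dist0_nonneg])
  have s: "0 < s n" and \<delta>: "0 \<le> \<delta> n" and
    upd: "ereal (c (Suc n)) = ereal (c n) + ereal (s n) * (\<omega> (dist0 (\<Phi> (x n))) + ereal (\<delta> n))" for n
    using assms(1) by (auto simp: primal_dual_sequence_def)
  have w: "\<omega> (dist0 (\<Phi> (x n))) = ereal (w n)" for n
    using \<omega>0[of n] upd[of n] s[of n] by (cases "\<omega> (dist0 (\<Phi> (x n)))") (auto simp: w_def)
  have w0: "0 \<le> w n" for n
    using \<omega>0[of n] by (simp add: w)
  have "c (Suc n) = c n + s n * w n + s n * \<delta> n" for n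
    using upd[of n] by (simp add: w algebra_simps)
  then have step: "c n + s n * w n \<le> c (Suc n)" for n
    using s[of n] \<delta>[of n] by simp
  have "0 \<le> c n" for n
  proof (induction n)
    case 0
    show ?case using assms(1) by (simp add: primal_dual_sequence_def)
  next
    case (Suc n)
    have "0 \<le> s n * w n" using s[of n] w0[of n] by simp
    then show ?case using Suc step[of n] by linarith
  qed
  then show ?thesis using that w w0 step by blast
qed

section \<open>Limit points and exactness\<close>

lemma lsc_at_within_le_liminf:
  assumes "lsc_at_within g p S" "\<And>n. u n \<in> S" "u \<longlonglongrightarrow> p"
  shows "g p \<le> liminf (\<lambda>n. g (u n))"
  unfolding le_Liminf_iff
proof (intro allI impI)
  fix l assume l: "l < g p"
  then have "l < Liminf (at p within S) g"
    using assms(1) by (auto simp: lsc_at_within_def)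
  then have "eventually (\<lambda>y. l < g y) (at p within S)"
    by (rule less_LiminfD)
  then have "eventually (\<lambda>y. y \<in> S \<longrightarrow> l < g y) (nhds p)"
    unfolding eventually_at_filter by eventually_elim (use l in auto)
  then have "eventually (\<lambda>n. u n \<in> S \<longrightarrow> l < g (u n)) sequentially"
    using assms(3) by (rule eventually_compose_filterlim)
  then show "eventually (\<lambda>n. l < g (u n)) sequentially"
    by eventually_elim (use assms(2) in auto)
qed

text \<open>A parameter for which \<open>F(\<sqdot>, c)\<close> stays above \<open>f\<^sub>*\<close> may still admit infeasible minimizers. Raising
  the parameter excludes them: at an infeasible point the penalty term is positive, because the values of
  \<open>\<Phi>\<close> are closed, so \<open>F\<close> rises strictly above \<open>f\<^sub>*\<close> there, while it keeps its value at feasible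
  points.\<close>

lemma exact_above_valid_parameter:
  assumes \<omega>: "penalty_weight \<tau> \<omega>" and closed: "\<forall>z\<in>Q. closed (\<Phi> z)"
    and fin: "\<bar>opt_value f Q \<Phi>\<bar> \<noteq> \<infinity>" and c: "0 \<le> c" "c < c'"
    and valid: "\<And>z. z \<in> Q \<Longrightarrow> opt_value f Q \<Phi> \<le> penalty_function f \<Phi> \<omega> z c"
  shows "c' \<in> exact_parameters f Q \<Phi> \<omega>"
proof -
  let ?F = "\<lambda>z. penalty_function f \<Phi> \<omega> z c'"
  let ?v = "opt_value f Q \<Phi>"
  have valid': "?v \<le> ?F z" if "z \<in> Q" for z
    using valid[OF that] penalty_function_mono[OF \<omega>, of c c'] c by (meson order_trans less_imp_le)
  have "z \<in> global_minimizers f (feasible Q \<Phi>)" if z: "z \<in> global_minimizers ?F Q" for z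
  proof -
    have zQ: "z \<in> Q" using z by (simp add: global_minimizers_def)
    have "?F z \<le> f y" if "y \<in> feasible Q \<Phi>" for y
      using z that penalty_function_feasible[OF \<omega> that, of f c']
      by (auto simp: global_minimizers_def feasible_def)
    then have le: "?F z \<le> ?v"
      unfolding opt_value_def by (rule INF_greatest)
    obtain v where v: "?v = ereal v" using fin by auto
    define t where "t = \<omega> (dist0 (\<Phi> z))"
    have t0: "0 \<le> t"
      unfolding t_def by (rule penalty_weight_nonneg[OF \<omega> dist0_nonneg])
    have F: "ereal v \<le> f z + pen_mult c t" "f z + pen_mult c' t \<le> ereal v"
      using valid[OF zQ] le by (simp_all add: penalty_function_def t_def v)
    obtain t' where t': "t = ereal t'"
      using F t0 by (cases t; cases "f z") (auto simp: pen_mult_def)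
    obtain a where a: "f z = ereal a"
      using F by (cases "f z") (auto simp: t')
    have "v \<le> a + c * t'" "a + c' * t' \<le> v"
      using F by (simp_all add: t' a)
    then have "(c' - c) * t' \<le> 0"
      by (simp add: algebra_simps)
    then have "t = 0"
      using c(2) t0 by (simp add: t' mult_le_0_iff zero_ereal_def)
    then have "dist0 (\<Phi> z) = 0"
      using penalty_weight_pos[OF \<omega>, of "dist0 (\<Phi> z)"] dist0_nonneg[of "\<Phi> z"]
      by (auto simp: t_def le_less)
    then have zf: "z \<in> feasible Q \<Phi>"
      using zQ closed by (auto simp: feasible_def intro: zero_in_closed_if_dist0_eq_0)
    have "f z \<le> ?v"
      using le by (simp add: penalty_function_feasible[OF \<omega> zf])
    then show ?thesis
      using zf by (auto simp: global_minimizers_def opt_value_def le_INF_iff)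
  qed
  moreover have "z \<in> global_minimizers ?F Q" if z: "z \<in> global_minimizers f (feasible Q \<Phi>)" for z
  proof -
    have zf: "z \<in> feasible Q \<Phi>" and "\<And>y. y \<in> feasible Q \<Phi> \<Longrightarrow> f z \<le> f y"
      using z by (auto simp: global_minimizers_def)
    then have "f z \<le> ?v"
      unfolding opt_value_def by (intro INF_greatest)
    then have "?F z \<le> ?v"
      by (simp add: penalty_function_feasible[OF \<omega> zf])
    then show ?thesis
      using zf valid' by (auto simp: global_minimizers_def feasible_def intro: order_trans)
  qed
  ultimately show ?thesis
    using c by (auto simp: exact_parameters_def)
qed

section \<open>Convergence of the primal-dual penalty method\<close>

theorem theorem3:
  fixes f :: "'a::metric_space \<Rightarrow> ereal"
    and \<Phi> :: "'a \<Rightarrow> 'b::real_normed_vector set"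
    and Q :: "'a set"
    and \<omega> :: "ereal \<Rightarrow> ereal"
    and \<tau> :: ereal
    and \<epsilon> s \<delta> c :: "nat \<Rightarrow> real"
    and x :: "nat \<Rightarrow> 'a"
    and s_star :: real
  defines "f_star \<equiv> opt_value f Q \<Phi>"
    and "\<beta> \<equiv> opt_value_fun f Q \<Phi>"
    and "eps_star \<equiv> limsup (\<lambda>n. ereal (\<epsilon> n))"
  assumes "Q \<noteq> {}" and "closed Q"
    and "\<And>z. f z \<noteq> -\<infinity>"
    and "feasible Q \<Phi> \<noteq> {}"
    and "\<bar>f_star\<bar> \<noteq> \<infinity>"
    and "penalty_weight \<tau> \<omega>"
    and "primal_dual_sequence f Q \<Phi> \<omega> \<epsilon> s \<delta> x c"
    and "\<exists>m::real. \<forall>z\<in>Q. ereal m \<le> penalty_function f \<Phi> \<omega> z (c 0)"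
    and "0 < s_star" and "\<And>n. s_star \<le> s n"
  shows "(\<lambda>n. dist0 (\<Phi> (x n))) \<longlonglongrightarrow> 0 \<and>
    min f_star (Liminf (at 0) \<beta>) \<le> liminf (\<lambda>n. f (x n)) \<and>
    liminf (\<lambda>n. f (x n)) \<le> limsup (\<lambda>n. f (x n)) \<and>
    limsup (\<lambda>n. f (x n)) \<le> min f_star (Liminf (at 0) \<beta>) + eps_star \<and>
    (\<beta> 0 \<le> Liminf (at 0) \<beta> \<longrightarrow>
      limsup (\<lambda>n. pen_mult (c n) (\<omega> (dist0 (\<Phi> (x n))))) \<le> eps_star \<and>
      (lsc_on Q f \<and> lsc_on Q (\<lambda>z. dist0 (\<Phi> z)) \<and> (\<forall>z\<in>Q. closed (\<Phi> z)) \<longrightarrow>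
        (\<forall>r p. strict_mono (r :: nat \<Rightarrow> nat) \<and> (x \<circ> r) \<longlonglongrightarrow> p \<longrightarrow> eps_optimal f Q \<Phi> eps_star p)) \<and>
      ((\<forall>z\<in>Q. closed (\<Phi> z)) \<and> eps_star = 0 \<and> bounded (range c) \<longrightarrow>
        globally_exact f Q \<Phi> \<omega> \<and>
        (\<exists>c_star. c \<longlonglongrightarrow> c_star \<and> least_exact_parameter f Q \<Phi> \<omega> \<le> ereal c_star)))"
proof -
  note Q_closed = assms(5) and f_proper = assms(6) and fin = assms(8) and \<omega> = assms(9) and pd = assms(10)
  define L where "L = min f_star (Liminf (at 0) \<beta>)"
  let ?F = "penalty_function f \<Phi> \<omega>"
  let ?d = "\<lambda>n. dist0 (\<Phi> (x n))"
  obtain w where w: "\<And>n. \<omega> (?d n) = ereal (w n)" "\<And>n. 0 \<le> w n"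
    and step: "\<And>n. c n + s n * w n \<le> c (Suc n)" and c0: "\<And>n. 0 \<le> c n"
    using primal_dual_sequence_realE[OF pd \<omega>] by blast
  have xQ: "x n \<in> Q" and \<epsilon>_bdd: "bdd_above (range \<epsilon>)"
    and xmin: "z \<in> Q \<Longrightarrow> ?F (x n) (c n) \<le> ?F z (c n) + ereal (\<epsilon> n)" for n z
    using pd by (auto simp: primal_dual_sequence_def)
  obtain m where m: "\<And>z. z \<in> Q \<Longrightarrow> ereal m \<le> ?F z (c 0)"
    using assms(11) by blast
  have step': "c n + s_star * w n \<le> c (Suc n)" for n
  proof -
    have "s_star * w n \<le> s n * w n" using assms(13) w(2) by (intro mult_right_mono)
    then show ?thesis using step[of n] by linarith
  qed
  have inc: "incseq c"
  proof (rule incseq_SucI)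
    fix n
    have "0 \<le> s_star * w n" using assms(12) w(2)[of n] by simp
    then show "c n \<le> c (Suc n)" using step'[of n] by linarith
  qed

  have key: "?F (x n) (c n) \<le> L + ereal (\<epsilon> n)" for n
  proof -
    have "?F (x n) (c n) - ereal (\<epsilon> n) \<le> (INF z\<in>Q. ?F z (c n))"
      using xmin[where n=n] by (intro INF_greatest) (simp add: ereal_minus_le)
    also have "\<dots> \<le> L"
      unfolding L_def f_star_def \<beta>_def by (rule penalty_infimum_le[OF \<omega> c0])
    finally show ?thesis by (simp add: ereal_minus_le)
  qed
  have f_le: "f (x n) \<le> L + ereal (\<epsilon> n)" for n
    using le_penalty_function[OF \<omega> c0] key by (rule order_trans)
  \<comment> \<open>The relaxed value is finite: \<open>f\<^sub>*\<close> bounds it above, and the lower bound on \<open>F(\<sqdot>, c\<^sub>0)\<close>, read at the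
    first iterate, bounds it below.\<close>
  have "L \<le> f_star" by (simp add: L_def)
  moreover have "ereal m \<le> L + ereal (\<epsilon> 0)"
    using m[OF xQ[of 0]] key[of 0] by (rule order_trans)
  ultimately obtain l where l: "L = ereal l"
    using fin by (cases L) auto
  have "\<exists>a. f (x n) = ereal a" for n
    using f_le[of n] f_proper[of "x n"] by (cases "f (x n)") (auto simp: l)
  then obtain g where g: "\<And>n. f (x n) = ereal (g n)" by metis
  have F_eq: "?F (x n) c' = ereal (g n + c' * w n)" for n c'
    by (simp add: penalty_function_def w g)
  have key': "g n + c n * w n \<le> l + \<epsilon> n" for n
    using key[of n] by (simp add: F_eq l)

  obtain E where E: "\<And>n. \<epsilon> n \<le> E"
    using \<epsilon>_bdd by (auto simp: bdd_above_def)
  have "(c n - c 0) * w n \<le> l + E - m" for n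
    using key'[of n] E[of n] m[OF xQ[of n]] by (simp add: F_eq algebra_simps)
  then have "w \<longlonglongrightarrow> 0"
    by (rule penalty_terms_tendsto_0[of w, OF w(2) assms(12) step'])
  then have "(\<lambda>n. \<omega> (?d n)) \<longlonglongrightarrow> 0"
    by (simp add: w zero_ereal_def)
  then have dist_lim: "?d \<longlonglongrightarrow> 0"
    by (rule tendsto_0_if_penalty_weight_tendsto_0[where d = ?d, OF \<omega> dist0_nonneg])

  have lower: "L \<le> liminf (\<lambda>n. f (x n))"
    unfolding le_Liminf_iff
  proof (intro allI impI)
    fix a assume "a < L"
    then obtain r where r: "0 < r" "\<And>z. z \<in> Q \<Longrightarrow> dist0 (\<Phi> z) < ereal r \<Longrightarrow> a < f z"
      using near_feasible_value_above unfolding L_def f_star_def \<beta>_def by blast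
    have "eventually (\<lambda>n. ?d n < ereal r) sequentially"
      using dist_lim r(1) by (auto intro: order_tendstoD(2))
    then show "eventually (\<lambda>n. a < f (x n)) sequentially"
      by eventually_elim (use r(2) xQ in auto)
  qed
  have mid: "liminf (\<lambda>n. f (x n)) \<le> limsup (\<lambda>n. f (x n))"
    by (rule Liminf_le_Limsup) simp
  have "limsup (\<lambda>n. f (x n)) \<le> limsup (\<lambda>n. L + ereal (\<epsilon> n))"
    using f_le by (intro Limsup_mono) auto
  also have "\<dots> = L + eps_star"
    unfolding eps_star_def by (rule Limsup_add_ereal_left) (auto simp: l)
  finally have upper: "limsup (\<lambda>n. f (x n)) \<le> L + eps_star" .

  have lsc_part: "limsup (\<lambda>n. pen_mult (c n) (\<omega> (?d n))) \<le> eps_star \<and>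
      (lsc_on Q f \<and> lsc_on Q (\<lambda>z. dist0 (\<Phi> z)) \<and> (\<forall>z\<in>Q. closed (\<Phi> z)) \<longrightarrow>
        (\<forall>r p. strict_mono (r :: nat \<Rightarrow> nat) \<and> (x \<circ> r) \<longlonglongrightarrow> p \<longrightarrow> eps_optimal f Q \<Phi> eps_star p)) \<and>
      ((\<forall>z\<in>Q. closed (\<Phi> z)) \<and> eps_star = 0 \<and> bounded (range c) \<longrightarrow>
        globally_exact f Q \<Phi> \<omega> \<and>
        (\<exists>c_star. c \<longlonglongrightarrow> c_star \<and> least_exact_parameter f Q \<Phi> \<omega> \<le> ereal c_star))"
    if "\<beta> 0 \<le> Liminf (at 0) \<beta>"
  proof -
    have L_eq: "L = f_star"
      using that by (simp add: L_def \<beta>_def f_star_def opt_value_fun_0)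

    have penalty: "limsup (\<lambda>n. pen_mult (c n) (\<omega> (?d n))) \<le> eps_star"
    proof (rule ereal_le_epsilon2)
      fix e :: real assume e: "0 < e"
      have "ereal (l - e) < L" using e by (simp add: l)
      then have "eventually (\<lambda>n. ereal (l - e) < f (x n)) sequentially"
        using lower by (auto intro: less_LiminfD less_le_trans)
      then have "eventually (\<lambda>n. pen_mult (c n) (\<omega> (?d n)) \<le> ereal (\<epsilon> n) + ereal e) sequentially"
      proof eventually_elim
        case (elim n)
        then show ?case using key'[of n] by (simp add: w g)
      qed
      then have "limsup (\<lambda>n. pen_mult (c n) (\<omega> (?d n))) \<le> limsup (\<lambda>n. ereal (\<epsilon> n) + ereal e)"
        by (rule Limsup_mono)
      also have "\<dots> = eps_star + ereal e"
        unfolding eps_star_def by (rule Limsup_add_ereal_right) auto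
      finally show "limsup (\<lambda>n. pen_mult (c n) (\<omega> (?d n))) \<le> eps_star + ereal e" .
    qed

    have limit_point: "eps_optimal f Q \<Phi> eps_star p"
      if lsc: "lsc_on Q f" "lsc_on Q (\<lambda>z. dist0 (\<Phi> z))" "\<forall>z\<in>Q. closed (\<Phi> z)"
        and r: "strict_mono r" "(x \<circ> r) \<longlonglongrightarrow> p" for r :: "nat \<Rightarrow> nat" and p
    proof -
      have pQ: "p \<in> Q"
        using closed_sequentially[OF Q_closed _ r(2)] xQ by simp
      have lim: "(\<lambda>n. x (r n)) \<longlonglongrightarrow> p" using r by (simp add: comp_def)
      have "dist0 (\<Phi> p) \<le> liminf (\<lambda>n. ?d (r n))"
        using lsc pQ by (intro lsc_at_within_le_liminf[OF _ _ lim, of _ Q]) (auto simp: lsc_on_def xQ)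
      also have "\<dots> = 0"
        using LIMSEQ_subseq_LIMSEQ[OF dist_lim, of r] r
        by (intro lim_imp_Liminf) (auto simp: comp_def)
      finally have "dist0 (\<Phi> p) = 0"
        using dist0_nonneg[of "\<Phi> p"] by simp
      then have feas: "p \<in> feasible Q \<Phi>"
        using lsc pQ by (auto simp: feasible_def intro: zero_in_closed_if_dist0_eq_0)
      have "f p \<le> liminf (\<lambda>n. f (x (r n)))"
        using lsc pQ by (intro lsc_at_within_le_liminf[OF _ _ lim, of _ Q]) (auto simp: lsc_on_def xQ)
      also have "\<dots> \<le> limsup (\<lambda>n. f (x (r n)))"
        by (rule Liminf_le_Limsup) simp
      also have "\<dots> \<le> limsup (\<lambda>n. f (x n))"
        using limsup_subseq_mono[of r "\<lambda>n. f (x n)"] r by (simp add: comp_def)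
      also note upper
      finally show ?thesis
        using feas by (simp add: eps_optimal_def L_eq f_star_def)
    qed

    have exactness: "globally_exact f Q \<Phi> \<omega> \<and>
        (\<exists>c_star. c \<longlonglongrightarrow> c_star \<and> least_exact_parameter f Q \<Phi> \<omega> \<le> ereal c_star)"
      if A: "\<forall>z\<in>Q. closed (\<Phi> z)" "eps_star = 0" "bounded (range c)"
    proof -
      obtain B where "\<And>n. \<bar>c n\<bar> \<le> B"
        using A(3) by (auto simp: bounded_iff)
      then have "\<And>n. c n \<le> B" by (meson abs_le_D1)
      then obtain c_star where lim: "c \<longlonglongrightarrow> c_star" and le: "\<And>n. c n \<le> c_star"
        using incseq_convergent[OF inc] by blast
      have cs0: "0 \<le> c_star" using c0[of 0] le[of 0] by linarith
      \<comment> \<open>The limiting parameter bounds every \<open>c\<^sub>n\<close>, so \<open>F(z, c\<^sub>n)\<close> can be replaced by its upper bound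
        \<open>F(z, c\<^sub>*)\<close> before the limit in \<open>n\<close> is taken.\<close>
      have valid: "opt_value f Q \<Phi> \<le> ?F z c_star" if z: "z \<in> Q" for z
      proof -
        have "f (x n) \<le> ereal (\<epsilon> n) + ?F z c_star" for n
        proof -
          have "f (x n) \<le> ?F (x n) (c n)" by (rule le_penalty_function[OF \<omega> c0])
          also have "\<dots> \<le> ?F z (c n) + ereal (\<epsilon> n)" by (rule xmin[OF z])
          also have "\<dots> \<le> ?F z c_star + ereal (\<epsilon> n)"
            by (intro add_right_mono penalty_function_mono[OF \<omega> le])
          finally show ?thesis by (simp add: add.commute)
        qed
        then have "limsup (\<lambda>n. f (x n)) \<le> limsup (\<lambda>n. ereal (\<epsilon> n) + ?F z c_star)"
          by (intro Limsup_mono) auto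
        also have "\<dots> \<le> eps_star + ?F z c_star"
        proof (cases "\<bar>?F z c_star\<bar> = \<infinity>")
          case True
          have "?F z c_star \<noteq> -\<infinity>"
            using le_penalty_function[OF \<omega> cs0, of f z \<Phi>] f_proper[of z] by auto
          then show ?thesis using True by auto
        next
          case False
          then show ?thesis
            unfolding eps_star_def by (subst Limsup_add_ereal_right) auto
        qed
        finally have "limsup (\<lambda>n. f (x n)) \<le> ?F z c_star" using A by simp
        with lower mid have "L \<le> ?F z c_star" by (meson order_trans)
        then show ?thesis by (simp add: L_eq f_star_def)
      qed
      have exact: "c' \<in> exact_parameters f Q \<Phi> \<omega>" if "c_star < c'" for c'
        using A fin by (intro exact_above_valid_parameter[OF \<omega> _ _ cs0 that valid]) (auto simp: f_star_def)
      then have "globally_exact f Q \<Phi> \<omega>"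
        unfolding globally_exact_def by (intro exI[of _ "c_star + 1"]) simp
      moreover have "least_exact_parameter f Q \<Phi> \<omega> \<le> ereal c_star"
      proof (rule ereal_le_epsilon2)
        fix e :: real assume "0 < e"
        then have "least_exact_parameter f Q \<Phi> \<omega> \<le> ereal (c_star + e)"
          unfolding least_exact_parameter_def by (intro INF_lower exact) simp
        then show "least_exact_parameter f Q \<Phi> \<omega> \<le> ereal c_star + ereal e" by simp
      qed
      ultimately show ?thesis
        using lim by blast
    qed
    show ?thesis
      using penalty limit_point exactness by blast
  qed
  show ?thesis
    using dist_lim lower mid upper lsc_part unfolding L_def by blast
qed

end
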